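(* Let $N\ge 2$, let $\Omega\subset\mathbb{R}^N$ be a bounded open set with Lipschitz boundary and $0\in\Omega$, let $\gamma>0$, $\lambda\ge N-1$, and let $f\in L^{N,\infty}(\Omega)$ be positive (i.e. $f>0$ a.e. in $\Omega$). Then the problem $$-\Delta_1 u=\frac{\lambda}{|x|}\,\mathrm{Sgn}(u)+\frac{f}{u^\gamma}\ \text{ in }\Omega,\qquad u=0\ \text{ on }\partial\Omega$$ admits no solution in the sense of the definition in the context.
   Context: $L^{N,\infty}(\Omega)$ is the Lorentz (weak-$L^N$) space. $\mathrm{Sgn}(s)=\{s/|s|\}$ for $s\ne0$, $\mathrm{Sgn}(0)=[-1,1]$. $X_{\mathcal M}(\Omega)$ (resp. $X_{\mathcal M_{loc}}(\Omega)$) is the set of ${\bf z}\in L^\infty(\Omega,\mathbb{R}^N)$ whose distributional divergence is a finite (resp. locally finite) Radon measure on $\Omega$. For such ${\bf z}$, $|\mathrm{div}\,{\bf z}|$ is absolutely continuous with respect to $\mathcal H^{N-1}$. For $v\in BV_{loc}(\Omega)$, $v^*$ denotes the precise representative (equal to the approximate limit where it exists and to the average $(v^++v^-)/2$ at approximate jump points; defined $\mathcal H^{N-1}$-a.e.). Pairing: for ${\bf z}\in X_{\mathcal M_{loc}}(\Omega)$ and $v\in BV_{loc}(\Omega)$ with $v^*\in L^1_{loc}(\Omega,\mathrm{div}\,{\bf z})$, define the distribution (in fact a Radon measure) $$\langle({\bf z},Dv),\varphi\rangle=-\int_\Omega v^*\varphi\,\mathrm{div}\,{\bf z}-\int_\Omega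 v\,{\bf z}\cdot\nabla\varphi\,dx,\quad\varphi\in C_c^\infty(\Omega).$$ Normal trace: for ${\bf w}\in X_{\mathcal M}(\Omega)$, $[{\bf w},\nu]\in L^\infty(\partial\Omega)$ is Anzellotti's weak trace of the normal component ($\nu$ outward unit normal), characterized by $\int_\Omega v\,\mathrm{div}\,{\bf w}+\int_\Omega{\bf w}\cdot\nabla v\,dx=\int_{\partial\Omega}v[{\bf w},\nu]\,d\mathcal H^{N-1}$ for $v\in C^1(\overline\Omega)$. Definition of solution: a nonnegative $u\in BV(\Omega)$ is a solution if there is ${\bf z}\in X_{\mathcal M_{loc}}(\Omega)$ with $\|{\bf z}\|_{L^\infty(\Omega)}\le1$ such that (a) $f/u^\gamma\in L^1_{loc}(\Omega)$ (with $f/u^\gamma=+\infty$ where $u=0<f$); (b) $\chi_{\{u>0\}}\in BV_{loc}(\Omega)$; (c) $-\chi_{\{u>0\}}^*\,\mathrm{div}\,{\bf z}=\frac{\lambda}{|x|}\chi_{\{u>0\}}+\frac{f}{u^\gamma}$ in $\mathcal D'(\Omega)$; (d) $({\bf z},Du)=|Du|$ as Radon measures on $\Omega$; (e) for every $0\le\phi\in C^1(\overline\Omega)\cap L^1(\Omega,\mathrm{div}\,{\bf z})$ with $\sup_\Omega\phi\le\phi(y)$ for all $y\in\partial\Omega$, and for $\mathcal H^{N-1}$-a.e. $x\in\partial\Omega$, one has $\lim_{\rho\downarrow0}\rho^{-N}\int_{\Omega\cap B_\rho(x)}u(y)\,dy=0$ or $\phi(x)+[\phi{\bf z},\nu](x)=0$.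 *)

theory Defs
  imports "HOL-Analysis.Analysis"
begin

text \<open>
  Functions on a set \<open>\<Omega>\<close> are total functions whose values outside \<open>\<Omega>\<close> (or outside its closure,
  where boundary values matter) are never used.  Equalities and inequalities between elements
  of Lebesgue spaces are almost-everywhere statements.
\<close>

subsection \<open>Smooth functions\<close>

definition gradient :: "('a::euclidean_space \<Rightarrow> real) \<Rightarrow> 'a \<Rightarrow> 'a" where
  "gradient \<phi> x = (\<Sum>b\<in>Basis. frechet_derivative \<phi> (at x) b *\<^sub>R b)"

primrec continuously_differentiable :: "nat \<Rightarrow> ('a::euclidean_space \<Rightarrow> real) \<Rightarrow> bool" where
  "continuously_differentiable 0 \<phi> \<longleftrightarrow> continuous_on UNIV \<phi>"
| "continuously_differentiable (Suc k) \<phi> \<longleftrightarrow>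
     (\<forall>x. \<phi> differentiable (at x)) \<and>
     (\<forall>b\<in>Basis. continuously_differentiable k (\<lambda>x. frechet_derivative \<phi> (at x) b))"

definition test_functions :: "'a::euclidean_space set \<Rightarrow> ('a \<Rightarrow> real) set" where
  "test_functions \<Omega> =
     {\<phi>. (\<forall>k. continuously_differentiable k \<phi>) \<and>
         compact (closure {x. \<phi> x \<noteq> 0}) \<and> closure {x. \<phi> x \<noteq> 0} \<subseteq> \<Omega>}"

definition C1_closure :: "'a::euclidean_space set \<Rightarrow> ('a \<Rightarrow> real) set" where
  "C1_closure \<Omega> =
     {v. continuous_on (closure \<Omega>) v \<and> (\<forall>x\<in>\<Omega>. v differentiable (at x)) \<and>
         (\<exists>G. continuous_on (closure \<Omega>) G \<and> (\<forall>x\<in>\<Omega>. G x = gradient v x))}"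

subsection \<open>Lebesgue and Lorentz spaces\<close>

definition L1_loc :: "'a::euclidean_space set \<Rightarrow> ('a \<Rightarrow> real) set" where
  "L1_loc \<Omega> = {v. \<forall>K. compact K \<and> K \<subseteq> \<Omega> \<longrightarrow> set_integrable lebesgue K v}"

definition L_infinity :: "'a measure \<Rightarrow> 'a set \<Rightarrow> ('a \<Rightarrow> 'b::euclidean_space) set" where
  "L_infinity M S =
     {w. set_borel_measurable M S w \<and> (\<exists>C. AE x in M. x \<in> S \<longrightarrow> norm (w x) \<le> C)}"

definition weak_Lp :: "real \<Rightarrow> 'a::euclidean_space set \<Rightarrow> ('a \<Rightarrow> real) set" where
  "weak_Lp p \<Omega> =
     {f. set_borel_measurable lebesgue \<Omega> f \<and>
         (\<exists>C\<ge>0. \<forall>t>0. emeasure lebesgue {x \<in> \<Omega>. t < \<bar>f x\<bar>} \<le> ennreal ((C / t) powr p))}"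

subsection \<open>Hausdorff measure\<close>

text \<open>
  Normalised by the volume of the \<open>k\<close>-dimensional unit ball, so that \<open>k\<close>-dimensional Hausdorff
  measure is surface measure.  The restriction of the outer measure to the Borel sets is a
  measure, because it is a metric outer measure; it is Borel regular, so that the null sets
  of this measure, in the sense of \<open>AE\<close>, are the null sets of the outer measure.
\<close>

definition hausdorff_content :: "nat \<Rightarrow> real \<Rightarrow> 'a::euclidean_space set \<Rightarrow> ennreal" where
  "hausdorff_content k \<delta> A =
     (INF C\<in>{C :: nat \<Rightarrow> 'a set. A \<subseteq> (\<Union>i. C i) \<and> (\<forall>i. bounded (C i) \<and> diameter (C i) \<le> \<delta>)}.
        \<Sum>i. if C i = {} then 0 else ennreal (unit_ball_vol (real k) * (diameter (C i) / 2) ^ k))"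

definition hausdorff_outer :: "nat \<Rightarrow> 'a::euclidean_space set \<Rightarrow> ennreal" where
  "hausdorff_outer k A = (SUP \<delta>\<in>{0<..}. hausdorff_content k \<delta> A)"

definition hausdorff_measure :: "nat \<Rightarrow> 'a::euclidean_space measure" where
  "hausdorff_measure k = measure_of UNIV (sets borel) (hausdorff_outer k)"

subsection \<open>Domains with Lipschitz boundary\<close>

text \<open>
  Near each boundary point \<open>\<Omega>\<close> is the region strictly below the graph, in some direction \<open>e\<close>,
  of a Lipschitz function \<open>g\<close> on the hyperplane orthogonal to \<open>e\<close>.
\<close>

definition lipschitz_boundary :: "'a::euclidean_space set \<Rightarrow> bool" where
  "lipschitz_boundary \<Omega> \<longleftrightarrow>
     (\<forall>x\<in>frontier \<Omega>. \<exists>r>0. \<exists>e g L. norm e = 1 \<and> L-lipschitz_on {y. y \<bullet> e = 0} g \<and>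
        \<Omega> \<inter> ball x r = {y \<in> ball x r. y \<bullet> e < g (y - (y \<bullet> e) *\<^sub>R e)})"

subsection \<open>Scalar and vector Radon measures, divergence measures, BV functions\<close>

text \<open>
  A (locally finite) real or vector valued Radon measure on \<open>\<Omega>\<close> is given by its polar
  decomposition \<open>\<sigma> \<mu>\<close>: here \<open>\<mu>\<close> is its total variation, a positive measure on the Borel sets
  of \<open>\<Omega>\<close>, and \<open>\<sigma>\<close> is a density of modulus one.  The measure determines \<open>\<mu>\<close> uniquely and
  \<open>\<sigma>\<close> up to \<open>\<mu>\<close>-null sets.
\<close>

definition radon_polar ::
    "'a::euclidean_space set \<Rightarrow> 'a measure \<Rightarrow> ('a \<Rightarrow> 'b::euclidean_space) \<Rightarrow> bool" where
  "radon_polar \<Omega> \<mu> \<sigma> \<longleftrightarrow>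
     sets \<mu> = sets (restrict_space borel \<Omega>) \<and>
     (\<forall>K. compact K \<and> K \<subseteq> \<Omega> \<longrightarrow> emeasure \<mu> K < \<infinity>) \<and>
     \<sigma> \<in> borel_measurable \<mu> \<and> (AE x in \<mu>. norm (\<sigma> x) = 1)"

text \<open>The distributional divergence of \<open>z\<close> is the Radon measure \<open>\<sigma> \<mu>\<close>; so \<open>\<bar>div z\<bar> = \<mu>\<close>.\<close>

definition has_divergence ::
    "'a::euclidean_space set \<Rightarrow> ('a \<Rightarrow> 'a) \<Rightarrow> 'a measure \<Rightarrow> ('a \<Rightarrow> real) \<Rightarrow> bool" where
  "has_divergence \<Omega> z \<mu> \<sigma> \<longleftrightarrow> radon_polar \<Omega> \<mu> \<sigma> \<and>
     (\<forall>\<phi>\<in>test_functions \<Omega>.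
        (LINT x:\<Omega>|lebesgue. z x \<bullet> gradient \<phi> x) = - (LINT x|\<mu>. \<phi> x * \<sigma> x))"

definition X_M_loc :: "'a::euclidean_space set \<Rightarrow> ('a \<Rightarrow> 'a) set" where
  "X_M_loc \<Omega> = {z \<in> L_infinity lebesgue \<Omega>. \<exists>\<mu> \<sigma>. has_divergence \<Omega> z \<mu> \<sigma>}"

definition X_M :: "'a::euclidean_space set \<Rightarrow> ('a \<Rightarrow> 'a) set" where
  "X_M \<Omega> = {z \<in> L_infinity lebesgue \<Omega>. \<exists>\<mu> \<sigma>. has_divergence \<Omega> z \<mu> \<sigma> \<and> emeasure \<mu> \<Omega> < \<infinity>}"

text \<open>The distributional gradient of \<open>v\<close> is the vector Radon measure \<open>\<sigma> \<mu>\<close>; so \<open>\<bar>Dv\<bar> = \<mu>\<close>.\<close>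

definition has_BV_gradient ::
    "'a::euclidean_space set \<Rightarrow> ('a \<Rightarrow> real) \<Rightarrow> 'a measure \<Rightarrow> ('a \<Rightarrow> 'a) \<Rightarrow> bool" where
  "has_BV_gradient \<Omega> v \<mu> \<sigma> \<longleftrightarrow> radon_polar \<Omega> \<mu> \<sigma> \<and>
     (\<forall>\<phi>\<in>test_functions \<Omega>.
        (LINT x:\<Omega>|lebesgue. v x *\<^sub>R gradient \<phi> x) = - (LINT x|\<mu>. \<phi> x *\<^sub>R \<sigma> x))"

definition BV_loc :: "'a::euclidean_space set \<Rightarrow> ('a \<Rightarrow> real) set" where
  "BV_loc \<Omega> = {v \<in> L1_loc \<Omega>. \<exists>\<mu> \<sigma>. has_BV_gradient \<Omega> v \<mu> \<sigma>}"

definition BV :: "'a::euclidean_space set \<Rightarrow> ('a \<Rightarrow> real) set" where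
  "BV \<Omega> = {v. set_integrable lebesgue \<Omega> v \<and>
              (\<exists>\<mu> \<sigma>. has_BV_gradient \<Omega> v \<mu> \<sigma> \<and> emeasure \<mu> \<Omega> < \<infinity>)}"

subsection \<open>Precise representative\<close>

definition half_ball :: "'a::euclidean_space \<Rightarrow> real \<Rightarrow> 'a \<Rightarrow> 'a set" where
  "half_ball x \<rho> n = {y \<in> ball x \<rho>. 0 < (y - x) \<bullet> n}"

definition mean_deviation :: "('a::euclidean_space \<Rightarrow> real) \<Rightarrow> real \<Rightarrow> 'a set \<Rightarrow> real" where
  "mean_deviation v a S = (LINT y:S|lebesgue. \<bar>v y - a\<bar>) / measure lebesgue S"

definition approximate_limit :: "('a::euclidean_space \<Rightarrow> real) \<Rightarrow> 'a \<Rightarrow> real \<Rightarrow> bool" where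
  "approximate_limit v x a \<longleftrightarrow> ((\<lambda>\<rho>. mean_deviation v a (ball x \<rho>)) \<longlongrightarrow> 0) (at_right 0)"

definition approximate_jump ::
    "('a::euclidean_space \<Rightarrow> real) \<Rightarrow> 'a \<Rightarrow> real \<Rightarrow> real \<Rightarrow> bool" where
  "approximate_jump v x a b \<longleftrightarrow> a \<noteq> b \<and>
     (\<exists>n. norm n = 1 \<and>
        ((\<lambda>\<rho>. mean_deviation v a (half_ball x \<rho> n)) \<longlongrightarrow> 0) (at_right 0) \<and>
        ((\<lambda>\<rho>. mean_deviation v b (half_ball x \<rho> (- n))) \<longlongrightarrow> 0) (at_right 0))"

text \<open>
  For a function in \<open>BV_loc \<Omega>\<close> the value 0 in the last case is only taken on a subset of \<open>\<Omega>\<close>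
  that is negligible for \<open>(N - 1)\<close>-dimensional Hausdorff measure, hence for \<open>\<bar>div z\<bar>\<close>.
\<close>

definition precise_rep :: "('a::euclidean_space \<Rightarrow> real) \<Rightarrow> 'a \<Rightarrow> real" where
  "precise_rep v x =
     (if \<exists>a. approximate_limit v x a then THE a. approximate_limit v x a
      else if \<exists>a b. approximate_jump v x a b
        then THE m. \<exists>a b. approximate_jump v x a b \<and> m = (a + b) / 2
      else 0)"

subsection \<open>Pairing and normal trace\<close>

text \<open>
  In \<open>pairing\<close> and \<open>pairing_defined\<close>, \<open>\<sigma> \<mu>\<close> is the divergence of \<open>z\<close>;
  \<open>pairing_defined\<close> says that \<open>v\<^sup>*\<close> is locally integrable with respect to it.
\<close>

definition pairing_defined ::
    "'a::euclidean_space set \<Rightarrow> 'a measure \<Rightarrow> ('a \<Rightarrow> real) \<Rightarrow> bool" where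
  "pairing_defined \<Omega> \<mu> v \<longleftrightarrow> v \<in> BV_loc \<Omega> \<and>
     (\<forall>K. compact K \<and> K \<subseteq> \<Omega> \<longrightarrow> set_integrable \<mu> K (precise_rep v))"

definition pairing ::
    "'a::euclidean_space set \<Rightarrow> ('a \<Rightarrow> 'a) \<Rightarrow> 'a measure \<Rightarrow> ('a \<Rightarrow> real) \<Rightarrow> ('a \<Rightarrow> real)
      \<Rightarrow> ('a \<Rightarrow> real) \<Rightarrow> real" where
  "pairing \<Omega> z \<mu> \<sigma> v \<phi> =
     - (LINT x|\<mu>. precise_rep v x * \<phi> x * \<sigma> x) - (LINT x:\<Omega>|lebesgue. v x * (z x \<bullet> gradient \<phi> x))"

definition is_normal_trace ::
    "'a::euclidean_space set \<Rightarrow> ('a \<Rightarrow> 'a) \<Rightarrow> ('a \<Rightarrow> real) \<Rightarrow> bool" where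
  "is_normal_trace \<Omega> w \<theta> \<longleftrightarrow>
     w \<in> X_M \<Omega> \<and> \<theta> \<in> L_infinity (hausdorff_measure (DIM('a) - 1)) (frontier \<Omega>) \<and>
     (\<exists>\<mu> \<sigma>. has_divergence \<Omega> w \<mu> \<sigma> \<and>
        (\<forall>v\<in>C1_closure \<Omega>.
           (LINT x|\<mu>. v x * \<sigma> x) + (LINT x:\<Omega>|lebesgue. w x \<bullet> gradient v x) =
           (LINT x:frontier \<Omega>|hausdorff_measure (DIM('a) - 1). v x * \<theta> x)))"

text \<open>For \<open>w \<in> X_M \<Omega>\<close> on a bounded Lipschitz domain the trace exists (Anzellotti) and is unique
  up to a null set of the boundary, so the choice is immaterial.\<close>

definition normal_trace :: "'a::euclidean_space set \<Rightarrow> ('a \<Rightarrow> 'a) \<Rightarrow> 'a \<Rightarrow> real" where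
  "normal_trace \<Omega> w = (SOME \<theta>. is_normal_trace \<Omega> w \<theta>)"

subsection \<open>Solutions\<close>

text \<open>In \<open>ennreal\<close>, \<open>a / 0 = \<infinity>\<close> for \<open>a > 0\<close>, as required where \<open>u\<close> vanishes.\<close>

definition singular_term :: "real \<Rightarrow> ('a \<Rightarrow> real) \<Rightarrow> ('a \<Rightarrow> real) \<Rightarrow> 'a \<Rightarrow> ennreal" where
  "singular_term \<gamma> f u x = ennreal (f x) / ennreal (u x powr \<gamma>)"

abbreviation positivity_indicator :: "('a \<Rightarrow> real) \<Rightarrow> 'a \<Rightarrow> real" where
  "positivity_indicator u \<equiv> indicator {x. 0 < u x}"

definition is_solution ::
    "'a::euclidean_space set \<Rightarrow> real \<Rightarrow> real \<Rightarrow> ('a \<Rightarrow> real) \<Rightarrow> ('a \<Rightarrow> real) \<Rightarrow> bool" where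
  "is_solution \<Omega> lam \<gamma> f u \<longleftrightarrow>
     u \<in> BV \<Omega> \<and> (AE x in lebesgue. x \<in> \<Omega> \<longrightarrow> 0 \<le> u x) \<and>
     (\<exists>z \<mu> \<sigma>.
        z \<in> X_M_loc \<Omega> \<and> has_divergence \<Omega> z \<mu> \<sigma> \<and>
        (AE x in lebesgue. x \<in> \<Omega> \<longrightarrow> norm (z x) \<le> 1) \<and>
        (\<forall>K. compact K \<and> K \<subseteq> \<Omega> \<longrightarrow> (\<integral>\<^sup>+x\<in>K. singular_term \<gamma> f u x \<partial>lebesgue) < \<infinity>) \<and>
        positivity_indicator u \<in> BV_loc \<Omega> \<and>
        (\<forall>\<phi>\<in>test_functions \<Omega>.
           - (LINT x|\<mu>. precise_rep (positivity_indicator u) x * \<phi> x * \<sigma> x) =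
           (LINT x:\<Omega>|lebesgue.
              (lam / norm x * positivity_indicator u x + enn2real (singular_term \<gamma> f u x)) * \<phi> x)) \<and>
        pairing_defined \<Omega> \<mu> u \<and>
        (\<exists>\<eta> \<tau>. has_BV_gradient \<Omega> u \<eta> \<tau> \<and>
           (\<forall>\<phi>\<in>test_functions \<Omega>. pairing \<Omega> z \<mu> \<sigma> u \<phi> = (LINT x|\<eta>. \<phi> x))) \<and>
        (\<forall>\<phi>\<in>C1_closure \<Omega>.
           (\<forall>x\<in>closure \<Omega>. 0 \<le> \<phi> x) \<and> integrable \<mu> \<phi> \<and>
           (\<forall>y\<in>frontier \<Omega>. (SUP x\<in>\<Omega>. \<phi> x) \<le> \<phi> y) \<longrightarrow>
           (AE x in hausdorff_measure (DIM('a) - 1). x \<in> frontier \<Omega> \<longrightarrow>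
              ((\<lambda>\<rho>. (LINT y:\<Omega> \<inter> ball x \<rho>|lebesgue. u y) / \<rho> ^ DIM('a)) \<longlongrightarrow> 0) (at_right 0) \<or>
              \<phi> x + normal_trace \<Omega> (\<lambda>y. \<phi> y *\<^sub>R z y) x = 0)))"

end

theory Submission
  imports Defs
begin

text \<open>
  A solution would contradict the sharp Hardy inequality
  \<open>(N - 1) \<integral> \<phi> / \<bar>x\<bar> \<le> \<integral> \<bar>\<nabla>\<phi>\<bar>\<close>, in which every radially decreasing \<open>\<phi>\<close> gives equality.

  Since \<open>f > 0\<close>, local integrability of \<open>f / u\<^sup>\<gamma>\<close> forces \<open>u > 0\<close> almost everywhere
  (\<open>positive_if_singular_term_locally_integrable\<close>).  Hence the precise representative of the
  indicator of \<open>{u > 0}\<close> is identically 1 on \<open>\<Omega>\<close> (\<open>precise_rep_AE_const\<close>), the factor in front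
  of \<open>div z\<close> disappears from the equation, and every test function \<open>\<phi> \<ge> 0\<close> satisfies
  \<open>\<lambda> \<integral> \<phi> / \<bar>x\<bar> + \<integral> \<phi> f / u\<^sup>\<gamma> = \<integral> z \<bullet> \<nabla>\<phi> \<le> \<integral> \<bar>\<nabla>\<phi>\<bar>\<close>, because \<open>\<bar>z\<bar> \<le> 1\<close>.  For a radially decreasing
  bump \<open>\<phi>\<close> in a small ball around the origin the right-hand side is \<open>(N - 1) \<integral> \<phi> / \<bar>x\<bar>\<close>
  (\<open>radial_bump_hardy_equality\<close>), which is finite and at most \<open>\<lambda> \<integral> \<phi> / \<bar>x\<bar>\<close>.  So
  \<open>\<integral> \<phi> f / u\<^sup>\<gamma> \<le> 0\<close>, although the integrand is positive almost everywhere on the ball.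

  The Hardy equality is a scaling argument.  Writing \<open>\<phi>(x) / \<bar>x\<bar>\<close> as the integral
  of \<open>\<bar>\<nabla>\<phi>\<bar>(t x)\<close> over \<open>t \<ge> 1\<close>, exchanging the integrals and rescaling, one is left with \<open>\<integral>\<^sub>1\<^sup>\<infinity> t\<^sup>-\<^sup>N dt = 1 / (N - 1)\<close>.  All integrands are nonnegative, so the same
  computation shows that \<open>\<phi> / \<bar>x\<bar>\<close> is integrable.
\<close>

section \<open>A smooth radial bump function\<close>

text \<open>
  The powers of \<open>t\<close> in the denominator are part of the family so that derivatives of its
  members are again linear combinations of members.
\<close>

definition flat_exp :: "nat \<Rightarrow> real \<Rightarrow> real" where
  "flat_exp k t = (if 0 < t then exp (- (1 / t)) / t ^ k else 0)"

lemma flat_exp_nonneg: "0 \<le> flat_exp k t"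
  by (simp add: flat_exp_def)

lemma flat_exp_eq_0: "t \<le> 0 \<Longrightarrow> flat_exp k t = 0"
  by (simp add: flat_exp_def)

lemma tendsto_flat_exp_0: "(flat_exp k \<longlongrightarrow> 0) (at 0)"
proof (rule filterlim_split_at)
  show "(flat_exp k \<longlongrightarrow> 0) (at_left 0)"
    by (rule tendsto_eventually) (auto simp: eventually_at_filter flat_exp_eq_0)
  have "((\<lambda>t::real. inverse t ^ k / exp (inverse t)) \<longlongrightarrow> 0) (at_right 0)"
    by (rule filterlim_compose[OF tendsto_power_div_exp_0 filterlim_inverse_at_top_right])
  moreover have "\<forall>\<^sub>F t in at_right 0. inverse t ^ k / exp (inverse t) = flat_exp k t"
    by (auto simp: eventually_at_filter flat_exp_def exp_minus field_simps)
  ultimately show "(flat_exp k \<longlongrightarrow> 0) (at_right 0)"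
    by (rule Lim_transform_eventually)
qed

lemma flat_exp_has_derivative:
  "(flat_exp k has_real_derivative flat_exp (k + 2) t - real k * flat_exp (k + 1) t) (at t)"
proof -
  consider "t > 0" | "t < 0" | "t = 0" by linarith
  then show ?thesis
  proof cases
    case 1
    have "((\<lambda>s. exp (- (1 / s)) / s ^ k) has_real_derivative
        flat_exp (k + 2) t - real k * flat_exp (k + 1) t) (at t)"
      by (rule derivative_eq_intros refl | use 1 in \<open>simp; fail\<close>)+
        (use 1 in \<open>cases k; simp add: flat_exp_def field_simps power2_eq_square\<close>)
    then show ?thesis
      by (rule has_field_derivative_transform_within_open[of _ _ _ "{0<..}"])
        (use 1 in \<open>auto simp: flat_exp_def\<close>)
  next
    case 2
    have "((\<lambda>s. 0) has_real_derivative flat_exp (k + 2) t - real k * flat_exp (k + 1) t) (at t)"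
      using 2 by (simp add: flat_exp_eq_0)
    then show ?thesis
      by (rule has_field_derivative_transform_within_open[of _ _ _ "{..<0}"])
        (use 2 in \<open>auto simp: flat_exp_def\<close>)
  next
    case 3
    have "(\<lambda>y. (flat_exp k y - flat_exp k 0) / (y - 0)) = flat_exp (k + 1)"
      by (auto simp: flat_exp_def)
    then show ?thesis
      using tendsto_flat_exp_0[of "k + 1"] 3
      by (simp add: has_field_derivative_iff flat_exp_eq_0)
  qed
qed

lemma continuous_on_flat_exp: "continuous_on S (flat_exp k)"
  by (meson DERIV_isCont continuous_at_imp_continuous_on flat_exp_has_derivative)

text \<open>
  An algebra of functions that contains the bump function and is closed under partial
  derivatives.  Its members are therefore smooth, by induction on the order of differentiability.
\<close>

inductive_set bump_algebra :: "real \<Rightarrow> ('a::euclidean_space \<Rightarrow> real) set" for R :: real where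
  const: "(\<lambda>x. c) \<in> bump_algebra R"
| coord: "(\<lambda>x. x \<bullet> b) \<in> bump_algebra R"
| flat: "(\<lambda>x. flat_exp k (R - x \<bullet> x)) \<in> bump_algebra R"
| add: "p \<in> bump_algebra R \<Longrightarrow> q \<in> bump_algebra R \<Longrightarrow> (\<lambda>x. p x + q x) \<in> bump_algebra R"
| mult: "p \<in> bump_algebra R \<Longrightarrow> q \<in> bump_algebra R \<Longrightarrow> (\<lambda>x. p x * q x) \<in> bump_algebra R"

lemma flat_radial_has_derivative:
  fixes x :: "'a::euclidean_space"
  shows "((\<lambda>x. flat_exp k (R - x \<bullet> x)) has_derivative
    (\<lambda>v. (flat_exp (k + 2) (R - x \<bullet> x) - real k * flat_exp (k + 1) (R - x \<bullet> x)) *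
      (- 2 * (x \<bullet> v)))) (at x)"
proof -
  have "((\<lambda>x. R - x \<bullet> x) has_derivative (\<lambda>v. - 2 * (x \<bullet> v))) (at x)"
    by (auto intro!: derivative_eq_intros simp: inner_commute)
  from has_derivative_compose[OF this
      flat_exp_has_derivative[unfolded has_field_derivative_def]]
  show ?thesis .
qed

lemma bump_algebra_differentiable:
  assumes "p \<in> bump_algebra R"
  shows "(\<forall>x. p differentiable (at x)) \<and>
    (\<forall>b. (\<lambda>x. frechet_derivative p (at x) b) \<in> bump_algebra R)"
  using assms
proof induction
  case (const c)
  then show ?case by (simp add: frechet_derivative_const bump_algebra.const)
next
  case (coord b)
  have D: "((\<lambda>x. x \<bullet> b) has_derivative (\<lambda>v. v \<bullet> b)) (at x)" for x :: 'a
    by (auto intro!: derivative_eq_intros)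
  then have "frechet_derivative (\<lambda>x. x \<bullet> b) (at x) = (\<lambda>v. v \<bullet> b)" for x :: 'a
    by (metis frechet_derivative_at)
  then show ?case using D by (auto simp: differentiable_def intro: bump_algebra.const)
next
  case (flat k)
  note D = flat_radial_has_derivative[of k R]
  have E: "frechet_derivative (\<lambda>x. flat_exp k (R - x \<bullet> x)) (at x) b =
      (flat_exp (k + 2) (R - x \<bullet> x) + (- real k) * flat_exp (k + 1) (R - x \<bullet> x)) *
      (- 2 * (x \<bullet> b))" for x b :: 'a
    unfolding frechet_derivative_at[OF D, symmetric] by simp
  have "(\<lambda>x. (flat_exp (k + 2) (R - x \<bullet> x) + (- real k) * flat_exp (k + 1) (R - x \<bullet> x)) *
      (- 2 * (x \<bullet> b))) \<in> bump_algebra R" for b :: 'a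
    by (intro bump_algebra.add bump_algebra.mult bump_algebra.flat bump_algebra.coord
        bump_algebra.const)
  then show ?case unfolding E using D unfolding differentiable_def by blast
next
  case (add p q)
  have "frechet_derivative (\<lambda>x. p x + q x) (at x) b =
      frechet_derivative p (at x) b + frechet_derivative q (at x) b" for x b
  proof -
    have "((\<lambda>x. p x + q x) has_derivative
        (\<lambda>h. frechet_derivative p (at x) h + frechet_derivative q (at x) h)) (at x)"
      using add frechet_derivative_works by (intro has_derivative_add) blast+
    from frechet_derivative_at[OF this, symmetric] show ?thesis by simp
  qed
  then show ?case using add by (auto intro: bump_algebra.add)
next
  case (mult p q)
  have "frechet_derivative (\<lambda>x. p x * q x) (at x) b =
      p x * frechet_derivative q (at x) b + frechet_derivative p (at x) b * q x" for x b
  proof -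
    have "((\<lambda>x. p x * q x) has_derivative
        (\<lambda>h. p x * frechet_derivative q (at x) h + frechet_derivative p (at x) h * q x)) (at x)"
      using mult frechet_derivative_works by (intro has_derivative_mult) blast+
    from frechet_derivative_at[OF this, symmetric] show ?thesis by simp
  qed
  then show ?case using mult by (auto intro!: bump_algebra.add bump_algebra.mult)
qed

lemma bump_algebra_continuously_differentiable:
  "p \<in> bump_algebra R \<Longrightarrow> continuously_differentiable k p"
proof (induction k arbitrary: p)
  case 0
  then show ?case
    using bump_algebra_differentiable[OF 0]
    by (auto intro!: continuous_at_imp_continuous_on differentiable_imp_continuous_within)
next
  case (Suc k)
  then show ?case using bump_algebra_differentiable[OF Suc.prems] by auto
qed

definition radial_bump :: "real \<Rightarrow> 'a::euclidean_space \<Rightarrow> real" where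
  "radial_bump r x = flat_exp 0 (r\<^sup>2 - x \<bullet> x)"

text \<open>
  The length of the gradient of \<open>radial_bump\<close>.  The exponent 2 appears because \<open>flat_exp 2\<close> is the
  derivative of \<open>flat_exp 0\<close>.
\<close>

definition radial_bump_slope :: "real \<Rightarrow> 'a::euclidean_space \<Rightarrow> real" where
  "radial_bump_slope r x = 2 * flat_exp 2 (r\<^sup>2 - x \<bullet> x) * norm x"

lemma radial_bump_nonneg: "0 \<le> radial_bump r x"
  by (simp add: radial_bump_def flat_exp_nonneg)

lemma radial_bump_le_1: "radial_bump r x \<le> 1"
  by (simp add: radial_bump_def flat_exp_def)

lemma radial_bump_slope_nonneg: "0 \<le> radial_bump_slope r x"
  by (simp add: radial_bump_slope_def flat_exp_nonneg)

lemma inner_ge_square_outside: "0 < r \<Longrightarrow> x \<notin> ball 0 r \<Longrightarrow> r\<^sup>2 \<le> x \<bullet> x"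
  for x :: "'a::euclidean_space"
  by (simp add: dot_square_norm)

lemma radial_bump_outside: "0 < r \<Longrightarrow> x \<notin> ball 0 r \<Longrightarrow> radial_bump r x = 0"
  using inner_ge_square_outside[of r x] by (simp add: radial_bump_def flat_exp_eq_0)

lemma radial_bump_slope_outside: "0 < r \<Longrightarrow> x \<notin> ball 0 r \<Longrightarrow> radial_bump_slope r x = 0"
  using inner_ge_square_outside[of r x] by (simp add: radial_bump_slope_def flat_exp_eq_0)

lemma radial_bump_pos: "x \<in> ball 0 r \<Longrightarrow> 0 < radial_bump r x"
  by (simp add: radial_bump_def flat_exp_def dot_square_norm power_strict_mono)

lemma radial_bump_test_function:
  assumes "0 < r" "cball 0 r \<subseteq> \<Omega>"
  shows "radial_bump r \<in> test_functions \<Omega>"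
proof -
  have supp: "{x. radial_bump r x \<noteq> 0} \<subseteq> cball 0 r"
    using radial_bump_outside[OF assms(1)] ball_subset_cball by blast
  from supp have sub: "closure {x. radial_bump r x \<noteq> 0} \<subseteq> cball 0 r"
    by (intro closure_minimal) auto
  have "compact (closure {x. radial_bump r x \<noteq> 0})"
    using bounded_subset[OF bounded_cball supp] by (simp only: compact_closure)
  moreover have "radial_bump r \<in> bump_algebra (r\<^sup>2)"
    using bump_algebra.flat[of 0 "r\<^sup>2"] by (simp add: radial_bump_def[abs_def])
  ultimately show ?thesis
    using sub assms(2) by (auto simp: test_functions_def intro: bump_algebra_continuously_differentiable)
qed

lemma gradient_radial_bump:
  fixes x :: "'a::euclidean_space"
  shows "gradient (radial_bump r) x = (- 2 * flat_exp 2 (r\<^sup>2 - x \<bullet> x)) *\<^sub>R x"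
proof -
  have "(radial_bump r has_derivative (\<lambda>v. flat_exp 2 (r\<^sup>2 - x \<bullet> x) * (- 2 * (x \<bullet> v)))) (at x)"
    using flat_radial_has_derivative[of 0 "r\<^sup>2" x]
    by (simp add: radial_bump_def[abs_def] numeral_2_eq_2)
  from frechet_derivative_at[OF this, symmetric]
  have "gradient (radial_bump r) x =
      (\<Sum>b\<in>Basis. (flat_exp 2 (r\<^sup>2 - x \<bullet> x) * (- 2 * (x \<bullet> b))) *\<^sub>R b)"
    by (simp add: gradient_def)
  also have "\<dots> = (- 2 * flat_exp 2 (r\<^sup>2 - x \<bullet> x)) *\<^sub>R (\<Sum>b\<in>Basis. (x \<bullet> b) *\<^sub>R b)"
    by (simp add: scaleR_sum_right mult.assoc mult.left_commute)
  finally show ?thesis by (simp add: euclidean_representation)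
qed

lemma norm_gradient_radial_bump: "norm (gradient (radial_bump r) x) = radial_bump_slope r x"
  by (simp add: gradient_radial_bump radial_bump_slope_def flat_exp_nonneg abs_mult)

lemma continuous_on_radial_bump: "continuous_on S (radial_bump r)"
  unfolding radial_bump_def
  by (intro continuous_on_compose2[OF continuous_on_flat_exp[of UNIV]] continuous_intros) auto

lemma continuous_on_radial_bump_slope: "continuous_on S (radial_bump_slope r)"
  unfolding radial_bump_slope_def
  by (intro continuous_intros continuous_on_compose2[OF continuous_on_flat_exp[of UNIV]]) auto

lemma borel_measurable_radial_bump [measurable]: "radial_bump r \<in> borel_measurable borel"
  by (intro borel_measurable_continuous_onI continuous_on_radial_bump)

lemma borel_measurable_radial_bump_slope [measurable]:
  "radial_bump_slope r \<in> borel_measurable borel"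
  by (intro borel_measurable_continuous_onI continuous_on_radial_bump_slope)

section \<open>Equality in the Hardy inequality\<close>

lemma nn_integral_lborel_scaleR:
  fixes G :: "'a::euclidean_space \<Rightarrow> ennreal"
  assumes [measurable]: "G \<in> borel_measurable borel" and "0 < t"
  shows "(\<integral>\<^sup>+x. G (t *\<^sub>R x) \<partial>lborel) = ennreal (1 / t ^ DIM('a)) * (\<integral>\<^sup>+x. G x \<partial>lborel)"
proof -
  have "(\<integral>\<^sup>+x. G x \<partial>lborel) = ennreal (t ^ DIM('a)) * (\<integral>\<^sup>+x. G (t *\<^sub>R x) \<partial>lborel)"
    using assms(2)
    by (subst lborel_affine[of t 0])
      (simp_all add: nn_integral_density nn_integral_distr nn_integral_cmult)
  then show ?thesis
    using assms(2) by (simp add: mult.assoc[symmetric] ennreal_mult[symmetric])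
qed

lemma nn_integral_inverse_power_atLeast_1:
  assumes "2 \<le> n"
  shows "(\<integral>\<^sup>+t. ennreal (1 / t ^ n) * indicator {1..} t \<partial>lborel) = ennreal (1 / (real n - 1))"
proof -
  obtain m where m: "n = Suc m" "m \<ge> 1" using assms by (cases n) auto
  have "(\<integral>\<^sup>+t. ennreal (1 / t ^ n) * indicator {1..} t \<partial>lborel) =
      ennreal (0 - (- (1 / (real m * 1 ^ m))))"
  proof (rule nn_integral_FTC_atLeast[where F = "\<lambda>t. - (1 / (real m * t ^ m))"])
    fix t :: real assume t: "1 \<le> t"
    show "((\<lambda>t. - (1 / (real m * t ^ m))) has_real_derivative 1 / t ^ n) (at t)"
    proof -
      have "((\<lambda>t. - (1 / real m) * inverse (t ^ m)) has_real_derivative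
          - (1 / real m) * - (inverse (t ^ m) * (real m * t ^ (m - 1)) * inverse (t ^ m))) (at t)"
        using t by (intro DERIV_cmult DERIV_inverse' DERIV_pow[THEN DERIV_cong]) auto
      also have "- (1 / real m) * - (inverse (t ^ m) * (real m * t ^ (m - 1)) * inverse (t ^ m)) =
          1 / t ^ n"
        using t m by (cases m) (simp_all add: field_simps del: of_nat_Suc)
      finally show ?thesis by (simp add: field_simps)
    qed
    show "0 \<le> 1 / t ^ n" using t by simp
  next
    have "filterlim (\<lambda>t::real. t ^ m) at_top at_top"
      using m by (intro filterlim_pow_at_top filterlim_ident) auto
    then have "((\<lambda>t::real. inverse (t ^ m)) \<longlongrightarrow> 0) at_top"
      by (rule filterlim_compose[OF tendsto_inverse_0_at_top, rotated, simplified]) (rule filterlim_ident)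
    then have "((\<lambda>t::real. - (1 / real m) * inverse (t ^ m)) \<longlongrightarrow> - (1 / real m) * 0) at_top"
      by (intro tendsto_intros)
    then show "((\<lambda>t. - (1 / (real m * t ^ m))) \<longlongrightarrow> 0) at_top"
      by (simp add: field_simps)
  qed simp
  then show ?thesis using m by simp
qed

text \<open>
  After Tonelli, the integral over \<open>x\<close> at fixed \<open>t\<close> is \<open>t\<^sup>-\<^sup>N\<close> times the integral of \<open>G\<close>.  It is here
  that the dimension must be at least 2: in dimension one \<open>1 / t\<close> is not integrable at infinity.
\<close>

lemma nn_integral_outer_ray_integral:
  fixes G :: "'a::euclidean_space \<Rightarrow> ennreal"
  assumes [measurable]: "G \<in> borel_measurable borel" and "2 \<le> DIM('a)"
  shows "(\<integral>\<^sup>+x. (\<integral>\<^sup>+t. G (t *\<^sub>R x) * indicator {1..} t \<partial>lborel) \<partial>lborel) =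
    ennreal (1 / (real DIM('a) - 1)) * (\<integral>\<^sup>+x. G x \<partial>lborel)"
proof -
  have "(\<integral>\<^sup>+x. (\<integral>\<^sup>+t. G (t *\<^sub>R x) * indicator {1..} t \<partial>lborel) \<partial>lborel) =
      (\<integral>\<^sup>+t. (\<integral>\<^sup>+x. G (t *\<^sub>R x) * indicator {1..} t \<partial>lborel) \<partial>lborel)"
    by (rule lborel_pair.Fubini') measurable
  also have "\<dots> = (\<integral>\<^sup>+t. (ennreal (1 / t ^ DIM('a)) * indicator {1..} t) *
      (\<integral>\<^sup>+x. G x \<partial>lborel) \<partial>lborel)"
  proof (rule nn_integral_cong)
    fix t :: real
    show "(\<integral>\<^sup>+x. G (t *\<^sub>R x) * indicator {1..} t \<partial>lborel) =
        (ennreal (1 / t ^ DIM('a)) * indicator {1..} t) * (\<integral>\<^sup>+x. G x \<partial>lborel)"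
      by (cases "1 \<le> t") (simp_all add: nn_integral_lborel_scaleR)
  qed
  also have "\<dots> = ennreal (1 / (real DIM('a) - 1)) * (\<integral>\<^sup>+x. G x \<partial>lborel)"
    using nn_integral_inverse_power_atLeast_1[OF assms(2)]
    by (subst nn_integral_multc) auto
  finally show ?thesis .
qed

text \<open>
  The fundamental theorem of calculus along the ray from \<open>x\<close> to infinity: the bump decreases
  along it at the rate \<open>\<bar>x\<bar> radial_bump_slope r (t x)\<close> and vanishes in the end.  At the origin both
  sides are 0, by the convention \<open>a / 0 = 0\<close>.
\<close>

lemma radial_bump_ray_integral:
  fixes x :: "'a::euclidean_space"
  assumes "0 < r"
  shows "ennreal (radial_bump r x / norm x) =
    (\<integral>\<^sup>+t. ennreal (radial_bump_slope r (t *\<^sub>R x)) * indicator {1..} t \<partial>lborel)"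
proof (cases "x = 0")
  case True
  then show ?thesis by (simp add: radial_bump_slope_def)
next
  case False
  let ?F = "\<lambda>t. - (flat_exp 0 (r\<^sup>2 - t\<^sup>2 * (x \<bullet> x)) / norm x)"
  have "(\<integral>\<^sup>+t. ennreal (radial_bump_slope r (t *\<^sub>R x)) * indicator {1..} t \<partial>lborel) =
      ennreal (0 - ?F 1)"
  proof (rule nn_integral_FTC_atLeast[where F = ?F])
    show "(\<lambda>t. radial_bump_slope r (t *\<^sub>R x)) \<in> borel_measurable borel" by measurable
    show "0 \<le> radial_bump_slope r (t *\<^sub>R x)" for t by (rule radial_bump_slope_nonneg)
    show "(?F has_real_derivative radial_bump_slope r (t *\<^sub>R x)) (at t)" if "1 \<le> t" for t
    proof -
      have "((\<lambda>t. r\<^sup>2 - t\<^sup>2 * (x \<bullet> x)) has_real_derivative - (2 * t * (x \<bullet> x))) (at t)"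
        by (auto intro!: derivative_eq_intros)
      from DERIV_chain2[OF flat_exp_has_derivative[of 0] this]
      have "(?F has_real_derivative
          - (flat_exp 2 (r\<^sup>2 - t\<^sup>2 * (x \<bullet> x)) * - (2 * t * (x \<bullet> x)) / norm x)) (at t)"
        by (intro DERIV_minus DERIV_cdivide) (simp add: numeral_2_eq_2)
      also have "- (flat_exp 2 (r\<^sup>2 - t\<^sup>2 * (x \<bullet> x)) * - (2 * t * (x \<bullet> x)) / norm x) =
          radial_bump_slope r (t *\<^sub>R x)"
        using that False
        by (simp add: radial_bump_slope_def power2_eq_square dot_square_norm mult_ac)
      finally show ?thesis .
    qed
    have "?F t = 0" if "t \<ge> r / norm x" for t
    proof -
      have "r \<le> norm (t *\<^sub>R x)"
        using that False assms by (simp add: field_simps) (smt (verit) mult_right_mono norm_ge_zero)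
      then have "r\<^sup>2 \<le> (norm (t *\<^sub>R x))\<^sup>2" using assms by (intro power_mono) auto
      then show ?thesis by (simp add: flat_exp_eq_0 dot_square_norm power_mult_distrib)
    qed
    then show "(?F \<longlongrightarrow> 0) at_top"
      by (intro tendsto_eventually) (auto simp: eventually_at_top_linorder)
  qed
  then show ?thesis by (simp add: radial_bump_def)
qed

lemma integrable_radial_bump_slope:
  "0 < r \<Longrightarrow> integrable lborel (radial_bump_slope r :: 'a::euclidean_space \<Rightarrow> real)"
proof -
  assume "0 < r"
  have "integrable lborel (\<lambda>x::'a. indicator (cball 0 r) x *\<^sub>R radial_bump_slope r x)"
    by (intro borel_integrable_compact continuous_on_radial_bump_slope) simp
  also have "(\<lambda>x::'a. indicator (cball 0 r) x *\<^sub>R radial_bump_slope r x) = radial_bump_slope r"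
    using radial_bump_slope_outside[OF \<open>0 < r\<close>] ball_subset_cball by (fastforce simp: indicator_def)
  finally show ?thesis .
qed

text \<open>
  The ray formula turns \<open>\<phi> / \<bar>x\<bar>\<close> into an outer ray integral of \<open>\<bar>\<nabla>\<phi>\<bar>\<close>, whose total integral is
  known.  The value is finite, so integrability of \<open>\<phi> / \<bar>x\<bar>\<close> comes out along with the equality.
\<close>

proposition radial_bump_hardy_equality:
  assumes "0 < r" "2 \<le> DIM('a::euclidean_space)"
  shows "has_bochner_integral lborel (\<lambda>x. radial_bump r (x::'a) / norm x)
    ((\<integral>x. radial_bump_slope r (x::'a) \<partial>lborel) / (real DIM('a) - 1))"
proof (rule has_bochner_integral_nn_integral)
  show "0 \<le> (\<integral>x. radial_bump_slope r (x::'a) \<partial>lborel) / (real DIM('a) - 1)"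
    using assms(2) by (simp add: radial_bump_slope_nonneg)
  have "(\<integral>\<^sup>+x. ennreal (radial_bump r x / norm (x::'a)) \<partial>lborel) =
      ennreal (1 / (real DIM('a) - 1)) * (\<integral>\<^sup>+x. ennreal (radial_bump_slope r (x::'a)) \<partial>lborel)"
    unfolding radial_bump_ray_integral[OF assms(1)]
    by (rule nn_integral_outer_ray_integral[OF _ assms(2)]) measurable
  also have "(\<integral>\<^sup>+x. ennreal (radial_bump_slope r (x::'a)) \<partial>lborel) =
      ennreal (\<integral>x. radial_bump_slope r (x::'a) \<partial>lborel)"
    by (intro nn_integral_eq_integral integrable_radial_bump_slope assms(1))
      (simp add: radial_bump_slope_nonneg)
  finally show "(\<integral>\<^sup>+x. ennreal (radial_bump r x / norm (x::'a)) \<partial>lborel) =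
      ennreal ((\<integral>x. radial_bump_slope r (x::'a) \<partial>lborel) / (real DIM('a) - 1))"
    using assms(2) by (simp add: ennreal_mult'[symmetric] radial_bump_slope_nonneg)
qed (auto simp: radial_bump_nonneg)


section \<open>Positivity and the precise representative\<close>

text \<open>
  Averages over small balls do not see null sets, so the approximate limit exists at every
  point of the open set, not only at almost every one.  This matters because the precise
  representative is integrated against \<open>div z\<close>, which may charge Lebesgue null sets.
\<close>

lemma precise_rep_AE_const:
  fixes v :: "'a::euclidean_space \<Rightarrow> real"
  assumes "open \<Omega>" "x \<in> \<Omega>" and v: "set_borel_measurable lebesgue \<Omega> v"
    and ae: "AE y in lebesgue. y \<in> \<Omega> \<longrightarrow> v y = c"
  shows "precise_rep v x = c"
proof -
  obtain e where e: "e > 0" "ball x e \<subseteq> \<Omega>"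
    using assms(1,2) by (meson open_contains_ball)
  have dev: "mean_deviation v a (ball x \<rho>) = \<bar>c - a\<bar>" if \<rho>: "0 < \<rho>" "\<rho> < e" for a \<rho>
  proof -
    have sub: "ball x \<rho> \<subseteq> \<Omega>" using e \<rho> by auto
    define w where "w y = indicator \<Omega> y *\<^sub>R v y" for y
    have [measurable]: "w \<in> borel_measurable lebesgue"
      using v by (simp add: set_borel_measurable_def w_def[abs_def])
    have [measurable]: "ball x \<rho> \<in> sets lebesgue" by simp
    have "(LINT y:ball x \<rho>|lebesgue. \<bar>v y - a\<bar>) =
        (LINT y|lebesgue. indicator (ball x \<rho>) y *\<^sub>R \<bar>w y - a\<bar>)"
      unfolding set_lebesgue_integral_def
      by (rule Bochner_Integration.integral_cong) (use sub in \<open>auto simp: indicator_def w_def\<close>)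
    also have "\<dots> = (LINT y|lebesgue. indicator (ball x \<rho>) y *\<^sub>R \<bar>c - a\<bar>)"
    proof (rule integral_cong_AE)
      show "AE y in lebesgue. indicator (ball x \<rho>) y *\<^sub>R \<bar>w y - a\<bar> =
          indicator (ball x \<rho>) y *\<^sub>R \<bar>c - a\<bar>"
        using ae by eventually_elim (use sub in \<open>auto simp: indicator_def w_def\<close>)
    qed measurable
    also have "\<dots> = measure lebesgue (ball x \<rho>) * \<bar>c - a\<bar>"
      by (subst integral_scaleR_left) (simp_all flip: lmeasurable_iff_integrable)
    finally show ?thesis
      using \<rho> content_ball_pos[of \<rho> x] by (simp add: mean_deviation_def)
  qed
  have lim: "((\<lambda>\<rho>. mean_deviation v a (ball x \<rho>)) \<longlongrightarrow> \<bar>c - a\<bar>) (at_right 0)" for a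
    by (rule tendsto_eventually) (use e dev in \<open>auto simp: eventually_at_right[of 0 e]\<close>)
  have "approximate_limit v x = (\<lambda>a. a = c)"
  proof
    fix a show "approximate_limit v x a \<longleftrightarrow> a = c"
    using tendsto_unique[OF trivial_limit_at_right_real lim[of a], of 0] lim[of a]
    by (auto simp: approximate_limit_def)
  qed
  then show ?thesis by (simp add: precise_rep_def)
qed

lemma borel_measurable_singular_term:
  assumes f: "set_borel_measurable lebesgue \<Omega> f" and u: "set_borel_measurable lebesgue \<Omega> u"
    and "K \<subseteq> \<Omega>" and [measurable]: "K \<in> sets lebesgue"
  shows "(\<lambda>x. singular_term \<gamma> f u x * indicator K x) \<in> borel_measurable lebesgue"
proof -
  have [measurable]: "(\<lambda>y. indicator \<Omega> y *\<^sub>R u y) \<in> borel_measurable lebesgue"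
      "(\<lambda>y. indicator \<Omega> y *\<^sub>R f y) \<in> borel_measurable lebesgue"
    using f u by (simp_all add: set_borel_measurable_def)
  have "(\<lambda>x. singular_term \<gamma> f u x * indicator K x) =
      (\<lambda>x. ennreal (indicator \<Omega> x *\<^sub>R f x) / ennreal ((indicator \<Omega> x *\<^sub>R u x) powr \<gamma>) *
        indicator K x)"
    using assms(3) by (intro ext) (auto simp: singular_term_def indicator_def)
  also have "\<dots> \<in> borel_measurable lebesgue" by measurable
  finally show ?thesis .
qed

text \<open>
  Where \<open>u\<close> vanishes the singular term is infinite, which can happen only on a null subset of
  each compact set; countably many compact sets exhaust \<open>\<Omega>\<close>.
\<close>

lemma positive_if_singular_term_locally_integrable:
  fixes \<Omega> :: "'a::euclidean_space set"
  assumes "open \<Omega>" and f: "set_borel_measurable lebesgue \<Omega> f"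
    and u: "set_borel_measurable lebesgue \<Omega> u"
    and fpos: "AE x in lebesgue. x \<in> \<Omega> \<longrightarrow> 0 < f x"
    and unonneg: "AE x in lebesgue. x \<in> \<Omega> \<longrightarrow> 0 \<le> u x"
    and int: "\<And>K. compact K \<Longrightarrow> K \<subseteq> \<Omega> \<Longrightarrow> (\<integral>\<^sup>+x\<in>K. singular_term \<gamma> f u x \<partial>lebesgue) < \<infinity>"
  shows "AE x in lebesgue. x \<in> \<Omega> \<longrightarrow> 0 < u x"
proof -
  obtain C :: "nat \<Rightarrow> 'a set" where C: "\<And>n. compact (C n)" "\<And>n. C n \<subseteq> \<Omega>" "(\<Union>n. C n) = \<Omega>"
    using open_Union_compact_subsets[OF \<open>open \<Omega>\<close>] by metis
  have "AE x in lebesgue. \<forall>n. singular_term \<gamma> f u x * indicator (C n) x \<noteq> \<infinity>"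
    unfolding AE_all_countable
  proof
    fix n
    show "AE x in lebesgue. singular_term \<gamma> f u x * indicator (C n) x \<noteq> \<infinity>"
      using C(1,2)[of n] int[of "C n"] borel_measurable_singular_term[OF f u]
      by (intro nn_integral_noteq_infinite) (auto simp: compact_imp_closed)
  qed
  then show ?thesis
    using fpos unonneg
  proof eventually_elim
    case (elim x)
    show ?case
    proof
      assume "x \<in> \<Omega>"
      then obtain n where "x \<in> C n" using C(3) by auto
      with elim(1) have "singular_term \<gamma> f u x \<noteq> \<infinity>"
        by (metis indicator_simps(1) mult.right_neutral)
      then have "u x \<noteq> 0"
        using elim \<open>x \<in> \<Omega>\<close> by (auto simp: singular_term_def ennreal_divide_zero)
      then show "0 < u x" using elim \<open>x \<in> \<Omega>\<close> by auto
    qed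
  qed
qed

section \<open>Nonexistence\<close>

theorem theorem8p1:
  fixes \<Omega> :: "(real ^ 'n) set" and f :: "real ^ 'n \<Rightarrow> real" and \<gamma> lam :: real
  assumes "CARD('n) \<ge> 2"
    and "bounded \<Omega>" and "open \<Omega>" and "lipschitz_boundary \<Omega>" and "0 \<in> \<Omega>"
    and "\<gamma> > 0" and "lam \<ge> real CARD('n) - 1"
    and "f \<in> weak_Lp (real CARD('n)) \<Omega>"
    and "AE x in lebesgue. x \<in> \<Omega> \<longrightarrow> 0 < f x"
  shows "\<not> (\<exists>u. is_solution \<Omega> lam \<gamma> f u)"
proof
  assume "\<exists>u. is_solution \<Omega> lam \<gamma> f u"
  then obtain u where sol: "is_solution \<Omega> lam \<gamma> f u" ..
  then have uBV: "u \<in> BV \<Omega>" and unonneg: "AE x in lebesgue. x \<in> \<Omega> \<longrightarrow> 0 \<le> u x"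
    unfolding is_solution_def by simp_all
  from sol obtain z \<mu> \<sigma> where div: "has_divergence \<Omega> z \<mu> \<sigma>"
    and z1: "AE x in lebesgue. x \<in> \<Omega> \<longrightarrow> norm (z x) \<le> 1"
    and sing: "\<forall>K. compact K \<and> K \<subseteq> \<Omega> \<longrightarrow>
       (\<integral>\<^sup>+x\<in>K. singular_term \<gamma> f u x \<partial>lebesgue) < \<infinity>"
    and eq: "\<forall>\<phi>\<in>test_functions \<Omega>.
       - (LINT x|\<mu>. precise_rep (positivity_indicator u) x * \<phi> x * \<sigma> x) =
       (LINT x:\<Omega>|lebesgue.
          (lam / norm x * positivity_indicator u x + enn2real (singular_term \<gamma> f u x)) * \<phi> x)"
    unfolding is_solution_def by (elim exE conjE) (rule that; assumption)
  have f: "set_borel_measurable lebesgue \<Omega> f"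
    using assms(8) by (simp add: weak_Lp_def)
  have u: "set_borel_measurable lebesgue \<Omega> u"
    using uBV by (auto simp: BV_def set_integrable_def set_borel_measurable_def)
  have upos: "AE x in lebesgue. x \<in> \<Omega> \<longrightarrow> 0 < u x"
    by (rule positive_if_singular_term_locally_integrable[where \<gamma> = \<gamma>,
          OF assms(3) f u assms(9) unonneg])
      (use sing in simp)
  \<comment> \<open>Multiplied by the indicator of \<open>\<Omega>\<close>, since the values of \<open>u\<close> elsewhere are arbitrary and
    need not be measurable.\<close>
  define pos where "pos x = (indicator \<Omega> x * positivity_indicator u x :: real)" for x
  have [measurable]: "pos \<in> borel_measurable lebesgue"
  proof -
    have [measurable]: "(\<lambda>y. indicator \<Omega> y *\<^sub>R u y) \<in> borel_measurable lebesgue"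
      using u by (simp add: set_borel_measurable_def)
    have "pos = (\<lambda>x. indicator {0<..} (indicator \<Omega> x *\<^sub>R u x))"
      by (auto simp: pos_def indicator_def)
    also have "\<dots> \<in> borel_measurable lebesgue" by measurable
    finally show ?thesis .
  qed
  have prec: "precise_rep (positivity_indicator u) x = 1" if "x \<in> \<Omega>" for x
  proof (rule precise_rep_AE_const[OF assms(3) that])
    show "set_borel_measurable lebesgue \<Omega> (positivity_indicator u)"
      using \<open>pos \<in> _\<close> by (simp add: set_borel_measurable_def pos_def[abs_def])
    show "AE y in lebesgue. y \<in> \<Omega> \<longrightarrow> positivity_indicator u y = (1::real)"
      using upos by eventually_elim auto
  qed

  obtain r where r: "r > 0" "cball 0 r \<subseteq> \<Omega>"
    using assms(3,5) by (meson open_contains_cball)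
  let ?\<phi> = "radial_bump r :: real ^ 'n \<Rightarrow> real"
  let ?s = "radial_bump_slope r :: real ^ 'n \<Rightarrow> real"
  note test = radial_bump_test_function[OF r]
  have outside: "?\<phi> x = 0" if "x \<notin> \<Omega>" for x
    using that r(2) ball_subset_cball[of 0 r] by (intro radial_bump_outside[OF r(1)]) blast
  \<comment> \<open>Cutting off with the indicator of the ball changes nothing, as the bump vanishes outside,
    but makes \<open>h\<close> measurable on the whole space.\<close>
  define h where "h x = enn2real (singular_term \<gamma> f u x * indicator (cball 0 r) x) * ?\<phi> x" for x
  have sing_meas [measurable]:
    "(\<lambda>x. singular_term \<gamma> f u x * indicator (cball 0 r) x) \<in> borel_measurable lebesgue"
    by (rule borel_measurable_singular_term[OF f u r(2)]) simp
  have \<phi>_meas [measurable]: "?\<phi> \<in> borel_measurable lebesgue"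
    by (intro measurable_completion) simp
  have [measurable]: "h \<in> borel_measurable lebesgue"
    unfolding h_def[abs_def] by measurable
  have h0: "0 \<le> h x" for x by (simp add: h_def radial_bump_nonneg)
  have h_int: "integrable lebesgue h"
  proof (rule integrableI_nonneg)
    have "(\<integral>\<^sup>+x. ennreal (h x) \<partial>lebesgue) \<le> (\<integral>\<^sup>+x\<in>cball 0 r. singular_term \<gamma> f u x \<partial>lebesgue)"
    proof (rule nn_integral_mono)
      fix x
      have "h x \<le> enn2real (singular_term \<gamma> f u x * indicator (cball 0 r) x)"
        unfolding h_def by (intro mult_left_le radial_bump_le_1) simp
      then have "ennreal (h x) \<le>
          ennreal (enn2real (singular_term \<gamma> f u x * indicator (cball 0 r) x))"
        by (rule ennreal_leI)
      also have "\<dots> \<le> singular_term \<gamma> f u x * indicator (cball 0 r) x"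
        by (simp only: ennreal_enn2real_if split: if_split) simp
      finally show "ennreal (h x) \<le> singular_term \<gamma> f u x * indicator (cball 0 r) x" .
    qed
    also have "\<dots> < \<infinity>" using sing[rule_format, of "cball 0 r"] r(2) by simp
    finally show "(\<integral>\<^sup>+x. ennreal (h x) \<partial>lebesgue) < \<infinity>" .
  qed (auto simp: h0)
  \<comment> \<open>The singular term is positive and finite almost everywhere in \<open>\<Omega>\<close>, so
    \<open>h\<close> is positive on the ball up to a null set.\<close>
  have h_pos: "0 < (LINT x|lebesgue. h x)"
  proof (rule ccontr)
    assume "\<not> ?thesis"
    moreover have "0 \<le> (LINT x|lebesgue. h x)" by (simp add: h0)
    ultimately have "(LINT x|lebesgue. h x) = 0" by linarith
    then have "AE x in lebesgue. h x = 0"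
      using integral_nonneg_eq_0_iff_AE[OF h_int] h0 by simp
    then have "AE x in lebesgue. x \<notin> ball (0 :: real ^ 'n) r"
      using upos assms(9)
    proof eventually_elim
      case (elim x)
      show ?case
      proof
        assume x: "x \<in> ball 0 r"
        with r have "x \<in> \<Omega>" by auto
        with elim have *: "0 < u x" "0 < f x" by auto
        then have "singular_term \<gamma> f u x = ennreal (f x / u x powr \<gamma>)"
          by (simp add: singular_term_def divide_ennreal)
        with * x radial_bump_pos[OF x] elim(1) show False
          by (auto simp: h_def)
      qed
    qed
    then have "negligible (ball (0 :: real ^ 'n) r)"
      by (subst negligible_iff_null_sets, subst AE_iff_null_sets) simp_all
    with r open_not_negligible[of "ball (0 :: real ^ 'n) r"] show False by simp
  qed

  have dim: "2 \<le> DIM(real ^ 'n)" using assms(1) by simp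
  have s_int: "integrable lebesgue ?s"
    using integrable_radial_bump_slope[OF r(1)] by (simp add: integrable_completion)
  have hardy: "has_bochner_integral lebesgue (\<lambda>x. ?\<phi> x / norm x)
      ((LINT x|lebesgue. ?s x) / (real CARD('n) - 1))"
    using radial_bump_hardy_equality[OF r(1) dim]
    by (simp add: has_bochner_integral_iff integrable_completion integral_completion)
  then have \<phi>_int: "integrable lebesgue (\<lambda>x. ?\<phi> x / norm x)"
    by (simp add: has_bochner_integral_iff)

  \<comment> \<open>Both ends of the following chain are the integral of \<open>\<bar>\<nabla>\<phi>\<bar>\<close>; the strict step is the
    contribution of the singular term.\<close>
  have "(LINT x|lebesgue. ?s x) = (real CARD('n) - 1) * (LINT x|lebesgue. ?\<phi> x / norm x)"
    using hardy assms(1) by (simp add: has_bochner_integral_iff)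
  also have "\<dots> \<le> lam * (LINT x|lebesgue. ?\<phi> x / norm x)"
    using assms(7) by (intro mult_right_mono integral_nonneg) (auto simp: radial_bump_nonneg)
  also have "\<dots> < lam * (LINT x|lebesgue. ?\<phi> x / norm x) + (LINT x|lebesgue. h x)"
    using h_pos by simp
  also have "\<dots> = (LINT x|lebesgue. lam * (?\<phi> x / norm x) + h x)"
    using \<phi>_int h_int by (simp del: times_divide_eq_right)
  also have "\<dots> = (LINT x|lebesgue. lam * (?\<phi> x / norm x) * pos x + h x)"
  proof (rule integral_cong_AE)
    show "AE x in lebesgue. lam * (?\<phi> x / norm x) + h x = lam * (?\<phi> x / norm x) * pos x + h x"
      using upos
    proof eventually_elim
      case (elim x)
      then show ?case
        using outside[of x] by (cases "x \<in> \<Omega>") (auto simp: pos_def)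
    qed
  qed (use borel_measurable_integrable[OF \<phi>_int] in measurable)
  also have "\<dots> = (LINT x:\<Omega>|lebesgue.
      (lam / norm x * positivity_indicator u x + enn2real (singular_term \<gamma> f u x)) * ?\<phi> x)"
    unfolding set_lebesgue_integral_def
  proof (rule Bochner_Integration.integral_cong)
    fix x
    show "lam * (?\<phi> x / norm x) * pos x + h x = indicator \<Omega> x *\<^sub>R
        ((lam / norm x * positivity_indicator u x + enn2real (singular_term \<gamma> f u x)) * ?\<phi> x)"
      using radial_bump_outside[OF r(1), of x] outside[of x] r(2)
      by (cases "x \<in> ball 0 r"; cases "x \<in> \<Omega>") (simp_all add: pos_def h_def field_simps)
  qed simp
  also have "\<dots> = - (LINT x|\<mu>. precise_rep (positivity_indicator u) x * ?\<phi> x * \<sigma> x)"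
    using eq test by simp
  also have "\<dots> = - (LINT x|\<mu>. ?\<phi> x * \<sigma> x)"
  proof -
    have "space \<mu> = \<Omega>"
      using div sets_eq_imp_space_eq[of \<mu> "restrict_space borel \<Omega>"]
      by (simp add: has_divergence_def radon_polar_def space_restrict_space)
    then show ?thesis using prec
      by (intro arg_cong[of _ _ uminus] Bochner_Integration.integral_cong) auto
  qed
  also have "\<dots> = (LINT x:\<Omega>|lebesgue. z x \<bullet> gradient ?\<phi> x)"
    using div test by (simp add: has_divergence_def)
  also have "\<dots> \<le> (LINT x|lebesgue. ?s x)"
    unfolding set_lebesgue_integral_def
  proof (rule integral_mono_AE'[OF s_int])
    show "AE x in lebesgue. indicator \<Omega> x *\<^sub>R (z x \<bullet> gradient ?\<phi> x) \<le> ?s x"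
      using z1
    proof eventually_elim
      case (elim x)
      have "z x \<bullet> gradient ?\<phi> x \<le> norm (z x) * ?s x"
        using norm_cauchy_schwarz[of "z x" "gradient ?\<phi> x"]
        by (simp add: norm_gradient_radial_bump)
      moreover have "norm (z x) * ?s x \<le> ?s x" if "x \<in> \<Omega>"
        using elim that by (intro mult_left_le_one_le radial_bump_slope_nonneg) auto
      ultimately show ?case
        using radial_bump_slope_nonneg[of r x] by (auto simp: indicator_def)
    qed
  qed (simp add: radial_bump_slope_nonneg)
  finally show False by simp
qed

end
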